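(* Let $a,b,c\in\mathbb{R}$ with $b=a^2/3$, and let $p(x)=x^3+ax^2+bx+c$. (I) If $c<\frac{1}{27}a^3$, then $p$ has only one real root $x_1$, and $x_1=-\frac a3+\sqrt[3]{\frac{a^3}{27}-c}>-\frac a3$. (II) If $c=\frac{1}{27}a^3$, then $p$ has a triple real root $x_1=x_2=x_3=-\frac a3$. (III) If $c>\frac{1}{27}a^3$, then $p$ has only one real root $x_1$, and $x_1=-\frac a3+\sqrt[3]{\frac{a^3}{27}-c}<-\frac a3$.
   Context: All coefficients are real, and $\sqrt[3]{\cdot}$ denotes the real cube root (negative for negative arguments). "Only one real root" means that the other two complex roots of $p$ form a pair of non-real complex conjugates. *)

theory Defs
  imports Complex_Main "HOL-Computational_Algebra.Computational_Algebra"
begin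

(* Roots are counted with multiplicity, so the multiset equation forces degree 3. *)
definition only_one_real_root :: "real poly \<Rightarrow> real \<Rightarrow> bool" where
  "only_one_real_root p x1 \<longleftrightarrow>
     {x. poly p x = 0} = {x1} \<and>
     (\<exists>z. z \<notin> \<real> \<and>
        proots (map_poly complex_of_real p) = {#complex_of_real x1, z, cnj z#})"

end

theory Submission
  imports Defs
begin

text \<open>For \<open>b = a^2/3\<close> the substitution \<open>y = x + a/3\<close> turns \<open>p\<close> into \<open>y^3 - (a^3/27 - c)\<close>. Hence the
  complex roots are \<open>-a/3 + s w^k\<close> for \<open>k = 0, 1, 2\<close>, where \<open>s\<close> is the real cube root of
  \<open>a^3/27 - c\<close> and \<open>w\<close> is a primitive cube root of unity.\<close>

text \<open>The general ring serves two uses: complex roots when \<open>s\<close> is nonzero, and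
  the real triple root.\<close>

lemma proots_three_linear_factors:
  fixes u v w :: "'a::idom"
  shows "proots ([:-u, 1:] * ([:-v, 1:] * [:-w, 1:])) = {#u, v, w#}"
proof -
  have nz: "[:-x, 1:] \<noteq> 0" for x :: 'a
    by simp
  have vw: "[:-v, 1:] * [:-w, 1:] \<noteq> 0"
    using nz mult_eq_0_iff by blast
  show ?thesis
    unfolding proots_mult[OF nz vw] proots_mult[OF nz nz] by simp
qed

text \<open>The left side is \<open>(x - e)^3 - s^3\<close> expanded. By the assumption
  \<open>-1 - w\<close> equals \<open>w^2\<close>, so the factors run over the three cube roots of
  \<open>s^3\<close>, shifted by \<open>e\<close>.\<close>

lemma cubic_factorization:
  fixes e s w :: "'a::idom"
  assumes "w^2 + w + 1 = 0"
  shows "[:- (e^3) - s^3, 3 * e^2, - 3 * e, 1:]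
       = [:-(e + s), 1:] * ([:-(e + s * w), 1:] * [:-(e + s * (-1 - w)), 1:])"
proof -
  have w: "w * w = - 1 - w"
    using assms by (simp add: power2_eq_square algebra_simps add_eq_0_iff)
  have prod: "s * w * (s * (-1 - w)) = s * s"
  proof -
    have "s * w * (s * (-1 - w)) = s * s * (- w - w * w)"
      by (simp add: algebra_simps)
    then show ?thesis
      by (simp add: w)
  qed
  define v v' where "v = s * w" and "v' = s * (-1 - w)"
  have v': "v' = - s - v"
    by (simp add: v_def v'_def algebra_simps)
  have sv: "v * v' = s * s"
    using prod by (simp add: v_def v'_def)
  \<comment> \<open>With \<open>v'\<close> eliminated, this is the one relation left; as a rewrite
    rule it reduces the expanded product to the coefficients on the left.\<close>
  have vv: "v * v = - s * s - s * v"
    using arg_cong[OF sv, of uminus] by (simp add: v' algebra_simps)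
  show ?thesis
    unfolding v_def[symmetric] v'_def[symmetric]
    by (simp add: v' algebra_simps power2_eq_square power3_eq_cube vv)
qed

lemma only_one_real_root_shifted_cube:
  fixes e s :: real
  assumes "s \<noteq> 0"
  shows "only_one_real_root [:- (e^3) - s^3, 3 * e^2, - 3 * e, 1:] (e + s)"
proof -
  let ?p = "[:- (e^3) - s^3, 3 * e^2, - 3 * e, 1:]"
  \<comment> \<open>This is exp(2 pi i / 3). Its conjugate is \<open>-1 - w\<close>, so the two
    non-real factors are conjugate; \<open>s \<noteq> 0\<close> keeps the imaginary part of
    \<open>z\<close> nonzero.\<close>
  define w where "w = Complex (-1/2) (sqrt 3 / 2)"
  define z where "z = of_real e + of_real s * w"
  have w: "w^2 + w + 1 = 0"
    by (simp add: w_def complex_eq_iff power2_eq_square)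
  have cnj_z: "cnj z = of_real e + of_real s * (-1 - w)"
    by (simp add: z_def w_def complex_eq_iff)
  have z: "z \<notin> \<real>"
    using assms by (simp add: z_def w_def complex_is_Real_iff)
  have "map_poly complex_of_real ?p
      = [:- (of_real e^3) - of_real s^3, 3 * of_real e^2, - 3 * of_real e, 1:]"
    by (simp add: map_poly_pCons)
  also have "\<dots> = [:-of_real (e + s), 1:] * ([:-z, 1:] * [:-cnj z, 1:])"
    using cubic_factorization[OF w, of "of_real e" "of_real s"] 
    unfolding cnj_z unfolding z_def of_real_add .
  finally have "proots (map_poly complex_of_real ?p) = {#complex_of_real (e + s), z, cnj z#}"
    by (simp only: proots_three_linear_factors)
  moreover have "poly ?p x = 0 \<longleftrightarrow> x = e + s" for x
  proof -
    have "poly ?p x = (x - e)^3 - s^3"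
      by (simp add: algebra_simps power2_eq_square power3_eq_cube)
    then have "poly ?p x = 0 \<longleftrightarrow> (x - e)^3 = s^3"
      by (simp only: right_minus_eq)
    \<comment> \<open>Real cube roots are unique, since 3 is odd.\<close>
    also have "\<dots> \<longleftrightarrow> x - e = s"
      using odd_real_root_unique[of 3 "x - e" "s^3"] odd_real_root_unique[of 3 s "s^3"] by auto
    finally show ?thesis
      by (simp add: algebra_simps)
  qed
  ultimately show ?thesis
    using z unfolding only_one_real_root_def by blast
qed

theorem theorem3:
  fixes a b c :: real and p :: "real poly"
  assumes "b = a^2 / 3"
    and "p = [:c, b, a, 1:]"
  shows
    "(c < 1/27 * a^3 \<longrightarrow>
       (\<exists>x1. only_one_real_root p x1 \<and>
             x1 = - a/3 + root 3 (a^3/27 - c) \<and> x1 > - a/3)) \<and>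
     (c = 1/27 * a^3 \<longrightarrow>
       (\<exists>x1 x2 x3. proots p = {#x1, x2, x3#} \<and> x1 = x2 \<and> x2 = x3 \<and> x3 = - a/3)) \<and>
     (c > 1/27 * a^3 \<longrightarrow>
       (\<exists>x1. only_one_real_root p x1 \<and>
             x1 = - a/3 + root 3 (a^3/27 - c) \<and> x1 < - a/3))"
proof -
  define s where "s = root 3 (a^3/27 - c)"
  have s3: "s^3 = a^3/27 - c"
    by (simp add: s_def odd_real_root_pow)
  \<comment> \<open>Here \<open>e = - a/3\<close>: the choice matches the quadratic coefficient, and
    \<open>b = a^2 / 3\<close> is exactly what makes the linear one agree.\<close>
  have p: "p = [:- ((- a/3)^3) - s^3, 3 * (- a/3)^2, - 3 * (- a/3), 1:]"
    unfolding s3 assms by (simp add: power2_eq_square power3_eq_cube)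
  have one: "only_one_real_root p (- a/3 + s)" if "s \<noteq> 0"
    unfolding p by (rule only_one_real_root_shifted_cube[OF that])
  have pos: "s > 0" if "c < 1/27 * a^3"
    using that by (simp add: s_def)
  have neg: "s < 0" if "c > 1/27 * a^3"
    using that by (simp add: s_def)
  \<comment> \<open>Here \<open>s = 0\<close> and \<open>p\<close> is the cube of
    \<open>x + a/3\<close>, so it splits already over the reals.\<close>
  have "proots p = {#- a/3, - a/3, - a/3#}" if "c = 1/27 * a^3"
  proof -
    have "p = [:-(- a/3), 1:] * ([:-(- a/3), 1:] * [:-(- a/3), 1:])"
      using that by (simp add: assms power2_eq_square power3_eq_cube)
    then show ?thesis
      by (simp only: proots_three_linear_factors)
  qed
  then show ?thesis
    using one pos neg unfolding s_def[symmetric] by fastforce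
qed

end
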